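(* Let an $s$-stage SSP Runge--Kutta method $(A,b)$, $A\in\mathbb{R}^{s\times s}$, $b\in\mathbb{R}^s$, be given such that for each $2\le j\le s$ row $j$ of $A$ is not identically zero, along with a dense output formula $\overline{b}=(\overline{b}_1,\dots,\overline{b}_s):[0,1]\to\mathbb{R}^s$ whose components are all twice right-differentiable at $0$, such that $\mathcal{C}(A,b,\overline{b})>0$. Then the order of accuracy of the dense output formula is at most two (that is, the dense output formula does not have order at least three).
   Context: An $s$-stage Runge--Kutta method $(A,b)$, with $A=(a_{i,j})\in\mathbb{R}^{s\times s}$ and $b\in\mathbb{R}^s$, approximates solutions of $u'=f(u)$ by $y_i=u_n+h\sum_{j=1}^s a_{i,j}f(y_j)$, $u_{n+1}=u_n+h\sum_{j=1}^s b_jf(y_j)$. Its abscissas are $c_i:=\sum_{j=1}^s a_{i,j}$. A dense output formula for it is given by a function $\overline{b}=(\overline{b}_1,\dots,\overline{b}_s):[0,1]\to\mathbb{R}^s$, via $u_{n+\theta}=u_n+h\sum_{j=1}^s\overline{b}_j(\theta)f(y_j)$. It has order at least three if and only if the following four conditions hold for all $\theta\in[0,1]$: $\sum_{j}\overline{b}_j(\theta)=\theta$; $\sum_{j}\overline{b}_j(\theta)c_j=\theta^2/2$; $\sum_{j}\overline{b}_j(\theta)c_j^2=\theta^3/3$; $\sum_{j}\sum_{k}\overline{b}_j(\theta)a_{j,k}c_k=\theta^3/6$ (all sums from $1$ to $s$). Let $e=(1,\dots,1)^\top\in\mathbb{R}^s$; all matrix/vector inequalities are componentwise. For $r\ge 0$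 such that $(I+rA)^{-1}$ exists consider the conditions (i) $A(I+rA)^{-1}\ge 0$ and $rA(I+rA)^{-1}e\le 1$; (ii) $b^\top(I+rA)^{-1}\ge 0$ and $rb^\top(I+rA)^{-1}e\le 1$; (iii) $\overline{b}(\theta)^\top(I+rA)^{-1}\ge 0$ and $r\overline{b}(\theta)^\top(I+rA)^{-1}e\le 1$ for all $0\le\theta\le 1$. The method is SSP (strong stability preserving) if (i) and (ii) hold for some $r>0$. $\mathcal{C}(A,b)$ is the supremum of the set of $r\ge 0$ for which $(I+rA)^{-1}$ exists and (i), (ii) hold (and $0$ if this set is empty). $\mathcal{C}(A,\overline{b})$ is the supremum of the set of $r\ge 0$ for which $(I+rA)^{-1}$ exists and (i), (iii) hold (and $0$ if this set is empty). Finally $\mathcal{C}(A,b,\overline{b}):=\min(\mathcal{C}(A,b),\mathcal{C}(A,\overline{b}))$. Suprema are taken in $[0,\infty]$. *)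

theory Defs
  imports "HOL-Analysis.Analysis"
begin

text \<open>
  The \<open>s\<close> stages are the elements of a finite index type \<^typ>\<open>'s\<close>. The orders \<open>\<le>\<close> on
  vectors and matrices and the vector \<open>1 :: real ^ 's\<close> (the all-ones vector) are the
  componentwise ones of the type \<open>vec\<close>.
\<close>

definition abscissa :: "real ^ 's ^ 's \<Rightarrow> 's \<Rightarrow> real" where
  "abscissa A i = (\<Sum>j\<in>UNIV. A $ i $ j)"

definition res_mat :: "real \<Rightarrow> real ^ 's ^ 's \<Rightarrow> real ^ 's ^ 's" where
  "res_mat r A = mat 1 + r *\<^sub>R A"

definition stage_cond :: "real ^ 's ^ 's \<Rightarrow> real \<Rightarrow> bool" where
  "stage_cond A r \<longleftrightarrow>
     0 \<le> A ** matrix_inv (res_mat r A) \<and>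
     r *\<^sub>R ((A ** matrix_inv (res_mat r A)) *v 1) \<le> 1"

definition weight_cond :: "real ^ 's ^ 's \<Rightarrow> real ^ 's \<Rightarrow> real \<Rightarrow> bool" where
  "weight_cond A b r \<longleftrightarrow>
     0 \<le> b v* matrix_inv (res_mat r A) \<and>
     r * ((b v* matrix_inv (res_mat r A)) \<bullet> 1) \<le> 1"

text \<open>
  Dense output weights are total functions on \<^typ>\<open>real\<close>; only their values on
  \<open>[0, 1]\<close> are ever used.
\<close>

definition dense_cond :: "real ^ 's ^ 's \<Rightarrow> (real \<Rightarrow> real ^ 's) \<Rightarrow> real \<Rightarrow> bool" where
  "dense_cond A bb r \<longleftrightarrow> (\<forall>\<theta>\<in>{0..1}. weight_cond A (bb \<theta>) r)"

definition SSP_method :: "real ^ 's ^ 's \<Rightarrow> real ^ 's \<Rightarrow> bool" where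
  "SSP_method A b \<longleftrightarrow>
     (\<exists>r>0. invertible (res_mat r A) \<and> stage_cond A r \<and> weight_cond A b r)"

text \<open>In \<^typ>\<open>ennreal\<close> the supremum of the empty set is \<open>0\<close>.\<close>

definition SSP_coeff :: "real ^ 's ^ 's \<Rightarrow> real ^ 's \<Rightarrow> ennreal" where
  "SSP_coeff A b =
     Sup (ennreal ` {r. 0 \<le> r \<and> invertible (res_mat r A) \<and> stage_cond A r \<and> weight_cond A b r})"

definition SSP_coeff_dense :: "real ^ 's ^ 's \<Rightarrow> (real \<Rightarrow> real ^ 's) \<Rightarrow> ennreal" where
  "SSP_coeff_dense A bb =
     Sup (ennreal ` {r. 0 \<le> r \<and> invertible (res_mat r A) \<and> stage_cond A r \<and> dense_cond A bb r})"

definition SSP_coeff_total ::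
    "real ^ 's ^ 's \<Rightarrow> real ^ 's \<Rightarrow> (real \<Rightarrow> real ^ 's) \<Rightarrow> ennreal" where
  "SSP_coeff_total A b bb = min (SSP_coeff A b) (SSP_coeff_dense A bb)"

text \<open>Order at least three of a dense output formula, given by its order conditions.\<close>

definition dense_order_ge_3 :: "real ^ 's ^ 's \<Rightarrow> (real \<Rightarrow> real ^ 's) \<Rightarrow> bool" where
  "dense_order_ge_3 A bb \<longleftrightarrow> (\<forall>\<theta>\<in>{0..1}.
     (\<Sum>j\<in>UNIV. bb \<theta> $ j) = \<theta> \<and>
     (\<Sum>j\<in>UNIV. bb \<theta> $ j * abscissa A j) = \<theta>\<^sup>2 / 2 \<and>
     (\<Sum>j\<in>UNIV. bb \<theta> $ j * (abscissa A j)\<^sup>2) = \<theta> ^ 3 / 3 \<and>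
     (\<Sum>j\<in>UNIV. \<Sum>k\<in>UNIV. bb \<theta> $ j * A $ j $ k * abscissa A k) = \<theta> ^ 3 / 6)"

text \<open>
  Right derivatives \<open>g x\<close> exist at all \<open>x\<close> in some \<open>[0, \<delta>)\<close>, and \<open>g\<close> has a right
  derivative at \<open>0\<close>. As \<open>\<delta> \<le> 1\<close>, this depends only on the values of \<open>f\<close> on \<open>[0, 1]\<close>.
\<close>

definition twice_right_differentiable_at_0 :: "(real \<Rightarrow> real) \<Rightarrow> bool" where
  "twice_right_differentiable_at_0 f \<longleftrightarrow>
     (\<exists>\<delta> g D. 0 < \<delta> \<and> \<delta> \<le> 1 \<and>
        (\<forall>x\<in>{0..<\<delta>}. (f has_real_derivative g x) (at_right x)) \<and>
        (g has_real_derivative D) (at_right 0))"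

end

theory Submission
  imports Defs
begin

text \<open>
  Put \<open>M = I + r A\<close>, \<open>K = A M\<^sup>-\<^sup>1\<close> and \<open>P = r K\<close>, so that \<open>P\<close> is nonnegative with row sums
  at most \<open>1\<close> and \<open>M = (I - P)\<^sup>-\<^sup>1\<close>. Then \<open>M \<ge> 0\<close>, hence \<open>A = K M \<ge> 0\<close>, and the dense output
  weights and the abscissas are nonnegative. If \<open>m\<close> is a positive lower bound of the positive
  abscissas, then \<open>m c\<^sub>j \<le> c\<^sub>j\<^sup>2\<close> for all \<open>j\<close>, so the second and third order conditions give
  \<open>m \<theta>\<^sup>2 / 2 \<le> \<theta>\<^sup>3 / 3\<close> for all \<open>\<theta>\<close> in \<open>[0, 1]\<close>, which fails for \<open>\<theta> = m\<close>.
\<close>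

lemma matrix_vector_mult_nonneg:
  fixes P :: "real ^ 'n ^ 'm"
  assumes "0 \<le> P" "0 \<le> x"
  shows "0 \<le> P *v x"
  using assms by (auto simp: less_eq_vec_def matrix_vector_mult_def intro!: sum_nonneg)

lemma matrix_vector_mult_mono:
  fixes P :: "real ^ 'n ^ 'm"
  assumes "0 \<le> P" "x \<le> y"
  shows "P *v x \<le> P *v y"
  using matrix_vector_mult_nonneg[of P "y - x"] assms
  by (simp add: matrix_vector_mult_diff_distrib)

text \<open>
  The vector \<open>z\<close> makes the partial sums of \<open>\<Sum>k. P\<^sup>k x\<close> telescope to \<open>z - P\<^sup>n z\<close>, which is
  bounded, while \<open>P x \<le> x\<close> bounds them above by \<open>n x\<close>.
\<close>

lemma substochastic_superharmonic_nonneg: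
  fixes P :: "real ^ 'n ^ 'n"
  assumes P: "0 \<le> P" "P *v 1 \<le> 1" and x: "P *v x \<le> x" and z: "x = z - P *v z"
  shows "0 \<le> x"
proof -
  \<comment> \<open>The norm dominates every entry of \<open>z\<close> and is nonnegative, so
    \<open>P 1 \<le> 1\<close> scales to \<open>P (B 1) \<le> B 1\<close>.\<close>
  define B where "B = norm z"
  have bound: "((*v) P ^^ n) z \<le> B *\<^sub>R 1" for n
  proof (induction n)
    case 0
    show ?case
      using component_le_norm_cart[of z] by (auto simp: less_eq_vec_def B_def abs_le_iff)
  next
    case (Suc n)
    have "P *v ((*v) P ^^ n) z \<le> B *\<^sub>R (P *v 1)"
      using matrix_vector_mult_mono[OF P(1) Suc.IH] by (simp add: matrix_vector_mult_scaleR)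
    also have "\<dots> \<le> B *\<^sub>R 1"
      using P(2) by (auto simp: less_eq_vec_def B_def intro: mult_left_le)
    finally show ?case by simp
  qed
  have sums: "z - ((*v) P ^^ n) z \<le> real n *\<^sub>R x" for n
  proof (induction n)
    case (Suc n)
    have "z - ((*v) P ^^ Suc n) z = x + P *v (z - ((*v) P ^^ n) z)"
      by (simp add: matrix_vector_mult_diff_distrib z)
    also have "\<dots> \<le> x + real n *\<^sub>R (P *v x)"
      using matrix_vector_mult_mono[OF P(1) Suc.IH] by (simp add: matrix_vector_mult_scaleR)
    also have "\<dots> \<le> x + real n *\<^sub>R x"
      using x by (auto simp: less_eq_vec_def intro: mult_left_mono)
    finally show ?case by (simp add: algebra_simps)
  qed simp
  have "0 \<le> x $ i" for i
  proof (rule ccontr)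
    assume neg: "\<not> 0 \<le> x $ i"
    \<comment> \<open>As \<open>x $ i\<close> is negative, \<open>n * x $ i\<close> eventually drops
      below the fixed number \<open>z $ i - B\<close>.\<close>
    then obtain n where "B - z $ i < real n * - (x $ i)"
      using reals_Archimedean3[of "- (x $ i)"] by auto
    moreover have "z $ i - (((*v) P ^^ n) z) $ i \<le> real n * x $ i"
      using sums[of n] by (simp add: less_eq_vec_def)
    moreover have "(((*v) P ^^ n) z) $ i \<le> B"
      using bound[of n] by (simp add: less_eq_vec_def)
    ultimately show False by simp
  qed
  then show ?thesis by (simp add: less_eq_vec_def)
qed

lemma matrix_inv_mult_left:
  assumes "invertible M"
  shows "matrix_inv M ** M = mat 1"
  using someI_ex[OF assms[unfolded invertible_def]] by (auto simp: matrix_inv_def)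

lemma nonneg_matrixI:
  fixes M :: "real ^ 'n ^ 'm"
  assumes "\<And>y. 0 \<le> y \<Longrightarrow> 0 \<le> M *v y"
  shows "0 \<le> M"
proof -
  have "0 \<le> M *v axis j 1" for j
    by (rule assms) (simp add: less_eq_vec_def axis_def)
  then have "0 \<le> M $ i $ j" for i j
    by (simp add: matrix_vector_mult_basis column_def less_eq_vec_def)
  then show ?thesis by (simp add: less_eq_vec_def)
qed

context
  fixes A :: "real ^ 's ^ 's" and r :: real
  assumes r: "0 \<le> r" and inv: "invertible (res_mat r A)" and stage: "stage_cond A r"
begin

lemma res_mat_nonneg: "0 \<le> res_mat r A"
proof (rule nonneg_matrixI)
  fix y :: "real ^ 's"
  assume y: "0 \<le> y"
  define M where "M = res_mat r A"
  define P where "P = r *\<^sub>R (A ** matrix_inv M)"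
  have "P ** M = r *\<^sub>R A"
    using matrix_inv_mult_left[OF inv]
    by (simp add: P_def M_def scalar_matrix_assoc matrix_mul_assoc[symmetric])
  \<comment> \<open>This is \<open>(I - P) M = I\<close> applied to \<open>v\<close>, as
    \<open>P M = r A = M - I\<close>.\<close>
  then have step: "v = M *v v - P *v (M *v v)" for v
    by (simp add: matrix_vector_mul_assoc)
      (simp add: M_def res_mat_def matrix_vector_mult_add_rdistrib)
  have "0 \<le> P" "P *v 1 \<le> 1"
    using stage r
    by (auto simp: stage_cond_def P_def M_def less_eq_vec_def scaleR_matrix_vector_assoc[symmetric])
  moreover have "P *v (M *v y) \<le> M *v y"
    using step[of y] y by (metis diff_ge_0_iff_ge)
  \<comment> \<open>\<open>step\<close> at \<open>v = M y\<close> supplies the witness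
    \<open>z = M (M y)\<close>.\<close>
  ultimately have "0 \<le> M *v y"
    using step by (rule substochastic_superharmonic_nonneg)
  then show "0 \<le> res_mat r A *v y" by (simp add: M_def)
qed

lemma stage_matrix_nonneg: "0 \<le> A"
proof (rule nonneg_matrixI)
  fix y :: "real ^ 's"
  assume "0 \<le> y"
  then have "0 \<le> (A ** matrix_inv (res_mat r A)) *v (res_mat r A *v y)"
    using stage res_mat_nonneg by (auto simp: stage_cond_def intro!: matrix_vector_mult_nonneg)
  also have "\<dots> = A *v y"
    using matrix_inv_mult_left[OF inv]
    by (simp add: matrix_vector_mul_assoc matrix_mul_assoc[symmetric])
  finally show "0 \<le> A *v y" .
qed

text \<open>Holds because \<open>w = (w M^-1) M\<close>, where both factors are nonnegative.\<close>

lemma weights_nonneg: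
  assumes "weight_cond A w r"
  shows "0 \<le> w"
proof -
  let ?M = "res_mat r A"
  define v where "v = w v* matrix_inv ?M"
  have v: "0 \<le> v" using assms by (simp add: weight_cond_def v_def)
  have "w = v v* ?M"
    using matrix_inv_mult_left[OF inv] by (simp add: v_def vector_matrix_mul_assoc)
  moreover have "0 \<le> v v* ?M"
    using v res_mat_nonneg
    by (auto simp: vector_matrix_mult_def less_eq_vec_def intro!: sum_nonneg mult_nonneg_nonneg)
  ultimately show ?thesis by simp
qed

end

lemma SSP_coeff_dense_posE:
  assumes "SSP_coeff_dense A bb > 0"
  obtains r where "0 < r" "invertible (res_mat r A)" "stage_cond A r" "dense_cond A bb r"
  using assms by (auto simp: SSP_coeff_dense_def less_Sup_iff)

lemma not_dense_order_ge_3_if_nonneg: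
  fixes A :: "real ^ 's ^ 's"
  assumes A: "0 \<le> A" and bb: "\<And>\<theta>. \<theta> \<in> {0..1} \<Longrightarrow> 0 \<le> bb \<theta>"
  shows "\<not> dense_order_ge_3 A bb"
proof
  assume order: "dense_order_ge_3 A bb"
  let ?c = "abscissa A"
  have c: "0 \<le> ?c j" for j
    using A by (auto simp: abscissa_def less_eq_vec_def intro!: sum_nonneg)
  \<comment> \<open>The extra \<open>1\<close> keeps the set nonempty if all abscissas vanish, and
    forces \<open>m \<le> 1\<close>, so that \<open>m\<close> is itself an admissible
    \<open>\<theta>\<close>.\<close>
  define m where "m = Min (insert 1 {?c j | j. 0 < ?c j})"
  have fin: "finite (insert 1 {?c j | j. 0 < ?c j})" by simp
  have m: "0 < m" "m \<le> 1"
    unfolding m_def by (subst Min_gr_iff[OF fin]; auto) (rule Min_le[OF fin], simp)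
  have mc: "m * ?c j \<le> (?c j)\<^sup>2" for j
  proof (cases "?c j = 0")
    case False
    then have "m \<le> ?c j"
      unfolding m_def using c[of j] by (intro Min_le[OF fin]) auto
    then show ?thesis using c[of j] by (simp add: power2_eq_square mult_right_mono)
  qed simp
  have "m * (\<Sum>j\<in>UNIV. bb m $ j * ?c j) = (\<Sum>j\<in>UNIV. bb m $ j * (m * ?c j))"
    by (simp add: sum_distrib_left mult.left_commute)
  also have "\<dots> \<le> (\<Sum>j\<in>UNIV. bb m $ j * (?c j)\<^sup>2)"
    using bb[of m] m by (intro sum_mono mult_left_mono mc) (auto simp: less_eq_vec_def)
  \<comment> \<open>The second and third order conditions at \<open>\<theta> = m\<close> evaluate
    the two sums.\<close>
  finally have "m * (m\<^sup>2 / 2) \<le> m ^ 3 / 3"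
    using order m unfolding dense_order_ge_3_def by (metis atLeastAtMost_iff less_imp_le)
  then have "m ^ 3 \<le> 0" by (simp add: field_simps power2_eq_square power3_eq_cube)
  with m show False by simp
qed

theorem theorem3:
  fixes A :: "real ^ 's::{finite,linorder} ^ 's::{finite,linorder}"
    and b :: "real ^ 's::{finite,linorder}"
    and bb :: "real \<Rightarrow> real ^ 's::{finite,linorder}"
  assumes "SSP_method A b"
    and "\<And>j. j \<noteq> Min UNIV \<Longrightarrow> row j A \<noteq> 0"
    and "\<And>j. twice_right_differentiable_at_0 (\<lambda>\<theta>. bb \<theta> $ j)"
    and "SSP_coeff_total A b bb > 0"
  shows "\<not> dense_order_ge_3 A bb"
proof -
  from assms(4) have "SSP_coeff_dense A bb > 0" by (simp add: SSP_coeff_total_def)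
  then obtain r where r: "0 < r" "invertible (res_mat r A)" "stage_cond A r"
    and dense: "dense_cond A bb r"
    by (rule SSP_coeff_dense_posE)
  show ?thesis
  proof (rule not_dense_order_ge_3_if_nonneg)
    show "0 \<le> A" using r by (intro stage_matrix_nonneg) auto
    show "0 \<le> bb \<theta>" if "\<theta> \<in> {0..1}" for \<theta>
      using weights_nonneg[of r A "bb \<theta>"] r dense that by (simp add: dense_cond_def)
  qed
qed

end
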